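(* Let $B$ be a finite bidirected graph rooted at $r$ that is edge-clean and trail-reachable, let $D=D_B^{\mathrm{trail}}$ be its trail-skeleton, and let $C_i$ be a trail-undirectable component of $B$ with associated vertex $c_i$. Then $\lambda_D(r,c_i)=1$ and $\lambda_B^{\mathrm{trail}}(r,x)=1$ for every $x\in V(C_i)$. Furthermore, if $B$ is path-reachable, then $\lambda_B^{\mathrm{path}}(r,x)=1$ for every $x\in V(C_i)$.
   Context: A bidirected graph $B=(G,\sigma)$ is a loopless multigraph $G$ together with a map $\sigma$ assigning to each half-edge $(e,u)$ ($u$ an endpoint of the edge $e$) a sign $\sigma(e,u)\in\{+,-\}$. An oriented edge $\vec e$ is an edge $e$ with a choice of which endpoint is its tail and which its head; $\overleftarrow{e}$ is the opposite orientation. A trail is a sequence $v_0\vec e_1v_1\dots\vec e_\ell v_\ell$ in which the edges $e_i$ are pairwise distinct, $\vec e_i$ has tail $v_{i-1}$ and head $v_i$, and $\sigma(e_{i+1},v_i)=-\sigma(e_i,v_i)$ for $1\le i<\ell$; it is a $v_0$--$v_\ell$ trail, trivial if $\ell=0$. A path is a trail that does not repeat vertices. Two trails are edge-disjoint if they share no underlying edge. $B$ is rooted if it has a designated root vertex $r$. An $r$-trail is a trail starting in $r$ with no internal vertex equal to $r$. An $r$--$\vec e$ trail (path) is an $r$-trail (path starting in $r$) whose last oriented edge is $\vec e$; an $r$--$e$ trail (path) is an $r$--$\vec e$ trail (path) for either orientation $\vec e$ of $e$. $B$ is trail-reachable (path-reachable) if for every edge $e$ there is an $r$--$e$ trail ($r$--$e$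 path). An edge $e$ is trail-undirectable if there are both an $r$--$\vec e$ trail and an $r$--$\overleftarrow{e}$ trail; it is trail-directable if exactly one orientation $\vec e$ of $e$ admits an $r$--$\vec e$ trail, and this $\vec e$ is the natural orientation of $e$. The trail-undirectable components $C_1,\dots,C_k$ of $B$ are the connected components (having at least one edge) of the subgraph formed by the trail-undirectable edges. $B$ is edge-clean if $r$ lies in no trail-undirectable component. Trail-skeleton (for trail-reachable $B$): for a component $C_i$ with $r\notin V(C_i)$ there is exactly one trail-directable edge $f_i$ whose natural orientation has its head in $V(C_i)$; let $c_i$ be this head. If $r\in V(C_i)$, let $c_i:=r$. Put $\pi(w)=c_i$ if $w\in V(C_i)$ and $\pi(w)=w$ if $w$ lies in no $C_i$. The trail-skeleton $D_B^{\mathrm{trail}}$ is the directed multigraph rooted at $r$ with vertex set $\pi(V(B))$, having for each trail-directable edge $e$ of $B$ with natural orientation from $u$ to $v$ one directed edge from $\pi(u)$ to $\pi(v)$. $\lambda_B^{\mathrm{trail}}(v,w)$ (resp. $\lambda_B^{\mathrm{path}}(v,w)$) is the maximum number of pairwise edge-disjoint $v$--$w$ trails (resp. paths) in $B$; $\lambda_D(v,w)$ is the maximum number of pairwise edge-disjoint directed $v$--$w$ paths in the directed graph $D$. *)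

theory Defs
  imports Graph_Theory.Arc_Walk
begin

section \<open>Undirected multigraphs and their components\<close>

text \<open>An edge is mapped to the set of its endpoints; only the values on \<open>gedges G\<close> matter.\<close>

record ('v, 'e) multigraph =
  gverts :: "'v set"
  gedges :: "'e set"
  gends :: "'e \<Rightarrow> 'v set"

locale loopless_multigraph =
  fixes G :: "('v, 'e, 'z) multigraph_scheme" (structure)
  assumes ends_in_verts: "e \<in> gedges G \<Longrightarrow> gends G e \<subseteq> gverts G"
    and card_ends: "e \<in> gedges G \<Longrightarrow> card (gends G e) = 2"

definition connected_in :: "('v, 'e) multigraph \<Rightarrow> 'v \<Rightarrow> 'v \<Rightarrow> bool" where
  "connected_in G u w \<longleftrightarrow> (u, w) \<in> {(a, b). \<exists>e \<in> gedges G. gends G e = {a, b}}\<^sup>*"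

definition component_of :: "('v, 'e) multigraph \<Rightarrow> 'v \<Rightarrow> ('v, 'e) multigraph" where
  "component_of G v =
    \<lparr>gverts = {w \<in> gverts G. connected_in G v w},
     gedges = {e \<in> gedges G. gends G e \<subseteq> {w \<in> gverts G. connected_in G v w}},
     gends = gends G\<rparr>"

definition components_of :: "('v, 'e) multigraph \<Rightarrow> ('v, 'e) multigraph set" where
  "components_of G = component_of G ` gverts G"


section \<open>Bidirected graphs, trails and paths\<close>

datatype sign = Plus | Minus

primrec opp_sign :: "sign \<Rightarrow> sign" where
  "opp_sign Plus = Minus"
| "opp_sign Minus = Plus"

text \<open>\<open>half_sign B e u\<close> is the sign of the half-edge \<open>(e, u)\<close>; it is only meaningful if
  \<open>u\<close> is an endpoint of \<open>e\<close>.\<close>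

record ('v, 'e) bidirected = "('v, 'e) multigraph" +
  half_sign :: "'e \<Rightarrow> 'v \<Rightarrow> sign"

locale rooted_bidirected_graph = loopless_multigraph B
  for B :: "('v, 'e) bidirected" (structure) and r :: 'v +
  assumes root_in_verts: "r \<in> gverts B"

locale finite_rooted_bidirected_graph = rooted_bidirected_graph +
  assumes finite_verts: "finite (gverts B)"
    and finite_edges: "finite (gedges B)"

text \<open>An oriented edge is a triple (tail, edge, head).\<close>

type_synonym ('v, 'e) oedge = "'v \<times> 'e \<times> 'v"

definition otail :: "('v, 'e) oedge \<Rightarrow> 'v" where "otail a = fst a"
definition oedge :: "('v, 'e) oedge \<Rightarrow> 'e" where "oedge a = fst (snd a)"
definition ohead :: "('v, 'e) oedge \<Rightarrow> 'v" where "ohead a = snd (snd a)"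

definition oriented_edges :: "('v, 'e) bidirected \<Rightarrow> ('v, 'e) oedge set" where
  "oriented_edges B = {(u, e, w). e \<in> gedges B \<and> gends B e = {u, w}}"

text \<open>A trail is given by its start vertex and the list of its oriented edges.\<close>

definition trail_verts :: "'v \<Rightarrow> ('v, 'e) oedge list \<Rightarrow> 'v list" where
  "trail_verts v p = v # map ohead p"

definition trail_edges :: "('v, 'e) oedge list \<Rightarrow> 'e set" where
  "trail_edges p = oedge ` set p"

definition consecutive :: "('v, 'e) bidirected \<Rightarrow> ('v, 'e) oedge \<Rightarrow> ('v, 'e) oedge \<Rightarrow> bool" where
  "consecutive B a b \<longleftrightarrow>
    otail b = ohead a \<and>
    half_sign B (oedge b) (ohead a) = opp_sign (half_sign B (oedge a) (ohead a))"

definition bi_trail :: "('v, 'e) bidirected \<Rightarrow> 'v \<Rightarrow> ('v, 'e) oedge list \<Rightarrow> 'v \<Rightarrow> bool" where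
  "bi_trail B v p w \<longleftrightarrow>
    v \<in> gverts B \<and> set p \<subseteq> oriented_edges B \<and> distinct (map oedge p) \<and>
    (p \<noteq> [] \<longrightarrow> otail (hd p) = v) \<and> successively (consecutive B) p \<and>
    w = last (trail_verts v p)"

definition bi_path :: "('v, 'e) bidirected \<Rightarrow> 'v \<Rightarrow> ('v, 'e) oedge list \<Rightarrow> 'v \<Rightarrow> bool" where
  "bi_path B v p w \<longleftrightarrow> bi_trail B v p w \<and> distinct (trail_verts v p)"

text \<open>The internal vertices of a trail \<open>p\<close> are the heads of all its edges but the last, so an
  \<open>r\<close>-trail may return to \<open>r\<close> with its last edge.\<close>

definition root_trail :: "('v, 'e) bidirected \<Rightarrow> 'v \<Rightarrow> ('v, 'e) oedge list \<Rightarrow> bool" where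
  "root_trail B r p \<longleftrightarrow> (\<exists>w. bi_trail B r p w) \<and> r \<notin> set (map ohead (butlast p))"

definition root_trail_to :: "('v, 'e) bidirected \<Rightarrow> 'v \<Rightarrow> ('v, 'e) oedge \<Rightarrow> bool" where
  "root_trail_to B r a \<longleftrightarrow> (\<exists>p. root_trail B r p \<and> p \<noteq> [] \<and> last p = a)"

definition root_path_to :: "('v, 'e) bidirected \<Rightarrow> 'v \<Rightarrow> ('v, 'e) oedge \<Rightarrow> bool" where
  "root_path_to B r a \<longleftrightarrow> (\<exists>p w. bi_path B r p w \<and> p \<noteq> [] \<and> last p = a)"

definition trail_reachable :: "('v, 'e) bidirected \<Rightarrow> 'v \<Rightarrow> bool" where
  "trail_reachable B r \<longleftrightarrow> (\<forall>e \<in> gedges B. \<exists>a. oedge a = e \<and> root_trail_to B r a)"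

definition path_reachable :: "('v, 'e) bidirected \<Rightarrow> 'v \<Rightarrow> bool" where
  "path_reachable B r \<longleftrightarrow> (\<forall>e \<in> gedges B. \<exists>a. oedge a = e \<and> root_path_to B r a)"


section \<open>Undirectable components and the trail-skeleton\<close>

definition trail_undirectable :: "('v, 'e) bidirected \<Rightarrow> 'v \<Rightarrow> 'e \<Rightarrow> bool" where
  "trail_undirectable B r e \<longleftrightarrow>
    (\<exists>u w. u \<noteq> w \<and> root_trail_to B r (u, e, w) \<and> root_trail_to B r (w, e, u))"

definition trail_directable :: "('v, 'e) bidirected \<Rightarrow> 'v \<Rightarrow> 'e \<Rightarrow> bool" where
  "trail_directable B r e \<longleftrightarrow> (\<exists>!a. oedge a = e \<and> root_trail_to B r a)"

definition natural_orientation :: "('v, 'e) bidirected \<Rightarrow> 'v \<Rightarrow> 'e \<Rightarrow> ('v, 'e) oedge" where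
  "natural_orientation B r e = (THE a. oedge a = e \<and> root_trail_to B r a)"

definition trail_undirectable_subgraph :: "('v, 'e) bidirected \<Rightarrow> 'v \<Rightarrow> ('v, 'e) multigraph" where
  "trail_undirectable_subgraph B r =
    \<lparr>gverts = (\<Union>e \<in> {e \<in> gedges B. trail_undirectable B r e}. gends B e),
     gedges = {e \<in> gedges B. trail_undirectable B r e},
     gends = gends B\<rparr>"

definition trail_undirectable_components ::
    "('v, 'e) bidirected \<Rightarrow> 'v \<Rightarrow> ('v, 'e) multigraph set" where
  "trail_undirectable_components B r =
    {C \<in> components_of (trail_undirectable_subgraph B r). gedges C \<noteq> {}}"

definition edge_clean :: "('v, 'e) bidirected \<Rightarrow> 'v \<Rightarrow> bool" where
  "edge_clean B r \<longleftrightarrow> (\<forall>C \<in> trail_undirectable_components B r. r \<notin> gverts C)"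

text \<open>For a component \<open>C\<close> avoiding the root of a trail-reachable graph, there is exactly one
  trail-directable edge naturally oriented towards \<open>C\<close>; the definite descriptions below rely
  on this.\<close>

definition entry_edge :: "('v, 'e) bidirected \<Rightarrow> 'v \<Rightarrow> ('v, 'e) multigraph \<Rightarrow> 'e" where
  "entry_edge B r C =
    (THE f. f \<in> gedges B \<and> trail_directable B r f \<and>
            ohead (natural_orientation B r f) \<in> gverts C)"

definition component_vertex :: "('v, 'e) bidirected \<Rightarrow> 'v \<Rightarrow> ('v, 'e) multigraph \<Rightarrow> 'v" where
  "component_vertex B r C =
    (if r \<in> gverts C then r else ohead (natural_orientation B r (entry_edge B r C)))"

definition skeleton_proj :: "('v, 'e) bidirected \<Rightarrow> 'v \<Rightarrow> 'v \<Rightarrow> 'v" where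
  "skeleton_proj B r w =
    (if \<exists>C \<in> trail_undirectable_components B r. w \<in> gverts C
     then component_vertex B r (THE C. C \<in> trail_undirectable_components B r \<and> w \<in> gverts C)
     else w)"

definition trail_skeleton :: "('v, 'e) bidirected \<Rightarrow> 'v \<Rightarrow> ('v, 'e) pre_digraph" where
  "trail_skeleton B r =
    \<lparr>verts = skeleton_proj B r ` gverts B,
     arcs = {e \<in> gedges B. trail_directable B r e},
     tail = (\<lambda>e. skeleton_proj B r (otail (natural_orientation B r e))),
     head = (\<lambda>e. skeleton_proj B r (ohead (natural_orientation B r e)))\<rparr>"


section \<open>Local edge-connectivity\<close>

text \<open>\<open>max_disjoint E S\<close> is the maximum size of a set of objects in \<open>S\<close> whose edge sets,
  given by \<open>E\<close>, are pairwise disjoint. It is only used for finite \<open>S\<close>, where the maximum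
  exists (the empty set is always a candidate).\<close>

definition max_disjoint :: "('p \<Rightarrow> 'e set) \<Rightarrow> 'p set \<Rightarrow> nat" where
  "max_disjoint E S = Max (card ` {P. P \<subseteq> S \<and> pairwise (\<lambda>p q. disjnt (E p) (E q)) P})"

definition lambda_trail :: "('v, 'e) bidirected \<Rightarrow> 'v \<Rightarrow> 'v \<Rightarrow> nat" where
  "lambda_trail B v w = max_disjoint trail_edges {p. bi_trail B v p w}"

definition lambda_path :: "('v, 'e) bidirected \<Rightarrow> 'v \<Rightarrow> 'v \<Rightarrow> nat" where
  "lambda_path B v w = max_disjoint trail_edges {p. bi_path B v p w}"

definition lambda_digraph :: "('v, 'e) pre_digraph \<Rightarrow> 'v \<Rightarrow> 'v \<Rightarrow> nat" where
  "lambda_digraph D v w = max_disjoint set {p. pre_digraph.apath D v p w}"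

end

theory Submission
  imports Defs
begin

text \<open>Everything follows from the fact that a trail-undirectable component \<open>C\<close> avoiding the root
  has only one entering edge. Let \<open>f\<close> be the edge with which some trail from the root first enters
  \<open>C\<close>. Call a set \<open>K\<close> of edges of \<open>C\<close> a blossom if every orientation of every edge of \<open>K\<close> is
  reached by a trail that runs inside \<open>K\<close> after \<open>f\<close>. A largest blossom is all of \<open>C\<close>: if an
  edge \<open>a\<close> of \<open>C\<close> leaves it, a root trail reaching \<open>a\<close> from outside yields, read backwards, either
  an ear to be added to \<open>K\<close> or a traversal against its natural orientation of a directable edge
  entering \<open>C\<close>, which is impossible. Any second entering edge could likewise be reached against
  its natural orientation through \<open>f\<close> and \<open>C\<close>. So \<open>f\<close> separates the root from \<open>C\<close>, both for trails
  and in the skeleton.\<close>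

section \<open>Reversal and concatenation of trails\<close>

lemma opp_sign_opp_sign [simp]: "opp_sign (opp_sign s) = s"
  by (cases s) auto

lemma opp_sign_neq [simp]: "opp_sign s \<noteq> s" "s \<noteq> opp_sign s"
  by (cases s; simp)+

lemma neq_opp_sign: "s \<noteq> opp_sign t \<longleftrightarrow> s = t"
  by (cases s; cases t) auto

definition orev :: "('v, 'e) oedge \<Rightarrow> ('v, 'e) oedge" where
  "orev a = (ohead a, oedge a, otail a)"

lemma orev_simps [simp]:
  "otail (orev a) = ohead a" "oedge (orev a) = oedge a" "ohead (orev a) = otail a"
  "orev (orev a) = a"
  by (auto simp: orev_def otail_def oedge_def ohead_def)

lemma oedge_triple [simp]: "otail (u, e, w) = u" "oedge (u, e, w) = e" "ohead (u, e, w) = w"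
  by (auto simp: otail_def oedge_def ohead_def)

lemma oedge_eqI:
  "otail a = otail b \<Longrightarrow> oedge a = oedge b \<Longrightarrow> ohead a = ohead b \<Longrightarrow> a = b"
  by (auto simp: otail_def oedge_def ohead_def prod_eq_iff)

lemma trail_edges_simps [simp]:
  "trail_edges [] = {}" "trail_edges (a # p) = insert (oedge a) (trail_edges p)"
  "trail_edges (p @ q) = trail_edges p \<union> trail_edges q"
  "trail_edges (rev p) = trail_edges p" "trail_edges (map orev p) = trail_edges p"
  by (simp_all add: trail_edges_def image_Un image_image)

lemma oriented_edges_iff:
  "a \<in> oriented_edges B \<longleftrightarrow> oedge a \<in> gedges B \<and> gends B (oedge a) = {otail a, ohead a}"
  by (cases a) (auto simp: oriented_edges_def)

lemma orev_oriented_edges [simp]: "orev a \<in> oriented_edges B \<longleftrightarrow> a \<in> oriented_edges B"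
  by (auto simp: oriented_edges_iff insert_commute)

lemma same_edge_cases:
  assumes "a \<in> oriented_edges B" "b \<in> oriented_edges B" "oedge a = oedge b"
  shows "a = b \<or> a = orev b"
proof -
  have "{otail a, ohead a} = {otail b, ohead b}"
    using assms by (auto simp: oriented_edges_iff)
  then show ?thesis
    using assms(3) by (auto simp: doubleton_eq_iff intro: oedge_eqI)
qed

lemma consecutive_orev [simp]: "consecutive B (orev b) (orev a) \<longleftrightarrow> consecutive B a b"
  unfolding consecutive_def by auto

text \<open>Whether an edge may follow \<open>x\<close> depends only on its tail and on its sign
  there, so two edges agreeing in both are interchangeable as continuations.\<close>

lemma consecutive_same_half_sign:
  assumes "consecutive B x b" "otail a = otail b"
    "half_sign B (oedge a) (otail a) = half_sign B (oedge b) (otail b)"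
  shows "consecutive B x a"
  using assms by (auto simp: consecutive_def)

text \<open>The part of \<open>bi_trail\<close> that mentions no end vertices. It passes to sublists
  and reversals, and the empty list needs no start vertex, so trails can be cut and glued
  freely.\<close>

definition linked_trail :: "('v, 'e) bidirected \<Rightarrow> ('v, 'e) oedge list \<Rightarrow> bool" where
  "linked_trail B p \<longleftrightarrow>
    set p \<subseteq> oriented_edges B \<and> distinct (map oedge p) \<and> successively (consecutive B) p"

lemma linked_trail_Nil [simp]: "linked_trail B []"
  by (simp add: linked_trail_def)

lemma linked_trail_append:
  "linked_trail B (p @ q) \<longleftrightarrow> linked_trail B p \<and> linked_trail B q \<and>
    trail_edges p \<inter> trail_edges q = {} \<and>
    (p \<noteq> [] \<and> q \<noteq> [] \<longrightarrow> consecutive B (last p) (hd q))"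
  by (auto simp: linked_trail_def trail_edges_def successively_append_iff)

lemma linked_trail_single [simp]: "linked_trail B [a] \<longleftrightarrow> a \<in> oriented_edges B"
  by (auto simp: linked_trail_def)

lemma linked_trail_Cons:
  "linked_trail B (a # q) \<longleftrightarrow> a \<in> oriented_edges B \<and> linked_trail B q \<and>
    oedge a \<notin> trail_edges q \<and> (q \<noteq> [] \<longrightarrow> consecutive B a (hd q))"
  using linked_trail_append[of B "[a]" q] by auto

lemma linked_trail_rev:
  assumes "linked_trail B p" shows "linked_trail B (rev (map orev p))"
  using assms
proof (induction p)
  case (Cons a p)
  then show ?case
    by (cases p) (auto simp: linked_trail_append linked_trail_Cons last_rev)
qed simp

lemma linked_trail_tail:
  assumes "linked_trail B (p @ a # q)" "p \<noteq> []"
  shows "otail a = ohead (last p)"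
  using assms by (auto simp: linked_trail_append consecutive_def)

text \<open>Every edge but the first starts at the head of its predecessor, and a predecessor is
  never the last edge. Facts about heads thus carry over to tails.\<close>

lemma linked_trail_tails:
  assumes "linked_trail B p" "a \<in> set p" "a \<noteq> hd p"
  shows "otail a \<in> ohead ` set (butlast p)"
proof -
  obtain p1 p2 where p: "p = p1 @ a # p2" using assms(2) by (meson split_list)
  with assms(3) have "p1 \<noteq> []" by auto
  then have "otail a = ohead (last p1)" "last p1 \<in> set p1"
    using linked_trail_tail[of B p1 a p2] assms(1) p by simp_all
  then show ?thesis using p by (auto simp: butlast_append)
qed

lemma bi_trail_linked:
  assumes "bi_trail B v p w"
  shows "linked_trail B p" "p \<noteq> [] \<Longrightarrow> otail (hd p) = v" "p \<noteq> [] \<Longrightarrow> ohead (last p) = w"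
    "p = [] \<Longrightarrow> w = v"
  using assms by (auto simp: bi_trail_def linked_trail_def trail_verts_def last_map)

lemma bi_trailI:
  assumes "v \<in> gverts B" "linked_trail B p" "p \<noteq> []" "otail (hd p) = v"
  shows "bi_trail B v p (ohead (last p))"
  using assms by (auto simp: bi_trail_def linked_trail_def trail_verts_def last_map)

section \<open>Trails from the root and their first entry into a vertex set\<close>

lemma root_trail_toE:
  assumes "root_trail_to B r a"
  obtains p where "linked_trail B (p @ [a])" "otail (hd (p @ [a])) = r"
proof -
  obtain q w where q: "bi_trail B r q w" "q \<noteq> []" "last q = a"
    using assms by (auto simp: root_trail_to_def root_trail_def)
  then have "q = butlast q @ [a]" by auto
  then show thesis using that[of "butlast q"] bi_trail_linked[OF q(1)] q(2) by auto
qed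

lemma root_trail_to_oriented: "root_trail_to B r a \<Longrightarrow> a \<in> oriented_edges B"
  by (elim root_trail_toE) (auto simp: linked_trail_append)

text \<open>The condition on internal vertices is no restriction: cut the trail at its last
  return to the root.\<close>

lemma root_trail_toI:
  assumes "r \<in> gverts B" "linked_trail B (p @ [a])" "otail (hd (p @ [a])) = r"
  shows "root_trail_to B r a"
proof (cases "r \<in> ohead ` set p")
  case False
  have "bi_trail B r (p @ [a]) (ohead (last (p @ [a])))"
    using bi_trailI[OF assms(1,2)] assms(3) by simp
  then show ?thesis
    using False unfolding root_trail_to_def root_trail_def
    by (intro exI[of _ "p @ [a]"]) auto
next
  case True
  then have "\<exists>x\<in>set p. ohead x = r" by auto
  from split_list_last_prop[OF this]
  obtain p1 x p2 where p: "p = p1 @ x # p2" "ohead x = r" "\<forall>y\<in>set p2. ohead y \<noteq> r"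
    by blast
  have l: "linked_trail B (p2 @ [a])" and c: "consecutive B x (hd (p2 @ [a]))"
    using assms(2) unfolding p by (auto simp: linked_trail_append linked_trail_Cons)
  then have "otail (hd (p2 @ [a])) = r" using p(2) by (auto simp: consecutive_def)
  then have "bi_trail B r (p2 @ [a]) (ohead (last (p2 @ [a])))"
    using bi_trailI[OF assms(1) l] by simp
  then show ?thesis
    using p(3) unfolding root_trail_to_def root_trail_def
    by (intro exI[of _ "p2 @ [a]"]) auto
qed

text \<open>Take the first edge \<open>f\<close> whose head lies in \<open>V\<close>. The tails up
  to and including that of \<open>f\<close> are the start vertex or heads of earlier edges, hence
  outside \<open>V\<close>.\<close>

lemma linked_trail_first_entry:
  assumes "linked_trail B p" "p \<noteq> []" "otail (hd p) \<notin> V" "ohead (last p) \<in> V"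
  obtains p1 f p2 where "p = p1 @ f # p2" "ohead f \<in> V" "otail f \<notin> V"
    "\<And>a. a \<in> set p1 \<Longrightarrow> otail a \<notin> V \<and> ohead a \<notin> V"
proof -
  have "\<exists>x\<in>set p. ohead x \<in> V" using assms by auto
  from split_list_first_prop[OF this]
  obtain p1 f p2 where p: "p = p1 @ f # p2" "ohead f \<in> V" "\<forall>y\<in>set p1. ohead y \<notin> V"
    by blast
  have l: "linked_trail B (p1 @ [f])"
    using assms(1) p(1) by (auto simp: linked_trail_append linked_trail_Cons)
  have h: "hd (p1 @ [f]) = hd p" using p(1) by (cases p1) auto
  have "otail a \<notin> V" if "a \<in> set (p1 @ [f])" for a
    using linked_trail_tails[OF l that] assms(3) h p(3) by (cases "a = hd p") auto
  then show thesis using that[OF p(1,2)] p(3) by auto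
qed

section \<open>Undirectable edges and their components\<close>

context finite_rooted_bidirected_graph
begin

lemma oriented_edgesD:
  assumes "a \<in> oriented_edges B"
  shows "oedge a \<in> gedges B" "gends B (oedge a) = {otail a, ohead a}" "otail a \<noteq> ohead a"
    "otail a \<in> gverts B" "ohead a \<in> gverts B"
proof -
  show 1: "oedge a \<in> gedges B" "gends B (oedge a) = {otail a, ohead a}"
    using assms by (auto simp: oriented_edges_iff)
  show "otail a \<noteq> ohead a" using card_ends[OF 1(1)] 1(2) by auto
  show "otail a \<in> gverts B" "ohead a \<in> gverts B"
    using ends_in_verts[OF 1(1)] 1(2) by auto
qed

lemma orientation_from:
  assumes "e \<in> gedges B" "v \<in> gends B e"
  obtains a where "a \<in> oriented_edges B" "oedge a = e" "otail a = v"
proof -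
  obtain x y where "gends B e = {x, y}"
    using card_ends[OF assms(1)] by (auto simp: card_2_iff)
  then obtain w where "gends B e = {v, w}" using assms(2) by auto
  then show thesis using assms(1) that[of "(v, e, w)"] by (auto simp: oriented_edges_iff)
qed

lemma trail_undirectableI:
  assumes "root_trail_to B r a" "root_trail_to B r (orev a)"
  shows "trail_undirectable B r (oedge a)"
proof -
  have "a = (otail a, oedge a, ohead a)" by (cases a) simp
  moreover have "orev a = (ohead a, oedge a, otail a)" by (rule orev_def)
  moreover have "otail a \<noteq> ohead a"
    using oriented_edgesD(3)[OF root_trail_to_oriented[OF assms(1)]] .
  ultimately show ?thesis
    unfolding trail_undirectable_def using assms by (intro exI conjI) simp_all
qed

lemma trail_undirectableD:
  assumes "trail_undirectable B r e" "a \<in> oriented_edges B" "oedge a = e"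
  shows "root_trail_to B r a"
proof -
  obtain u w where u: "root_trail_to B r (u, e, w)" "root_trail_to B r (w, e, u)"
    using assms(1) by (auto simp: trail_undirectable_def)
  have "a = (u, e, w) \<or> a = orev (u, e, w)"
    using same_edge_cases[OF assms(2) root_trail_to_oriented[OF u(1)]] assms(3) by simp
  then show ?thesis using u by (auto simp: orev_def)
qed

text \<open>The only other orientation of the edge is \<open>orev a\<close>, and reaching it as well
  would make the edge undirectable.\<close>

lemma natural_orientation_eq:
  assumes "root_trail_to B r a" "\<not> trail_undirectable B r (oedge a)"
  shows "trail_directable B r (oedge a)" "natural_orientation B r (oedge a) = a"
proof -
  have unique: "b = a" if "oedge b = oedge a \<and> root_trail_to B r b" for b
  proof -
    have "b \<noteq> orev a" using that assms(2) trail_undirectableI[OF assms(1)] by blast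
    moreover have "b = a \<or> b = orev a"
      using same_edge_cases[OF root_trail_to_oriented[OF conjunct2[OF that]]
          root_trail_to_oriented[OF assms(1)] conjunct1[OF that]] .
    ultimately show ?thesis by blast
  qed
  show "trail_directable B r (oedge a)"
    unfolding trail_directable_def by (rule ex1I[of _ a]) (use assms(1) unique in simp_all)
  show "natural_orientation B r (oedge a) = a"
    unfolding natural_orientation_def by (rule the_equality) (use assms(1) unique in simp_all)
qed

lemma trail_directableD:
  assumes "trail_directable B r e"
  shows "root_trail_to B r (natural_orientation B r e)"
    "oedge (natural_orientation B r e) = e" "\<not> trail_undirectable B r e"
proof -
  have "oedge (natural_orientation B r e) = e \<and> root_trail_to B r (natural_orientation B r e)"
    using theI'[OF assms[unfolded trail_directable_def]] unfolding natural_orientation_def .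
  then show "root_trail_to B r (natural_orientation B r e)"
    "oedge (natural_orientation B r e) = e" by auto
  show "\<not> trail_undirectable B r e"
    using assms unfolding trail_directable_def trail_undirectable_def
    by (metis oedge_triple(1,2))
qed

text \<open>The relation inside \<open>connected_in\<close>, named so that closure rules apply to
  it. It is symmetric, so components are classes of an equivalence.\<close>

definition adj :: "('a \<times> 'a) set" where
  "adj = {(a, b). \<exists>e \<in> gedges (trail_undirectable_subgraph B r).
    gends (trail_undirectable_subgraph B r) e = {a, b}}"

lemma connected_in_adj:
  "connected_in (trail_undirectable_subgraph B r) u w \<longleftrightarrow> (u, w) \<in> adj\<^sup>*"
  by (simp add: connected_in_def adj_def)

lemma adj_iff: "(a, b) \<in> adj \<longleftrightarrow>
    (\<exists>e \<in> gedges B. trail_undirectable B r e \<and> gends B e = {a, b})"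
  by (auto simp: adj_def trail_undirectable_subgraph_def)

lemma undirectable_subgraph_vert_iff: "v \<in> gverts (trail_undirectable_subgraph B r) \<longleftrightarrow>
    (\<exists>e \<in> gedges B. trail_undirectable B r e \<and> v \<in> gends B e)"
  by (auto simp: trail_undirectable_subgraph_def)

lemma sym_adj_rtrancl: "sym (adj\<^sup>*)"
  by (rule sym_rtrancl) (auto simp: sym_def adj_iff insert_commute)

lemma undirectable_componentE:
  assumes "C \<in> trail_undirectable_components B r"
  obtains v where "v \<in> gverts (trail_undirectable_subgraph B r)"
    "gverts C = {w \<in> gverts (trail_undirectable_subgraph B r). (v, w) \<in> adj\<^sup>*}"
    "gedges C = {e \<in> gedges B. trail_undirectable B r e \<and> gends B e \<subseteq> gverts C}"
    "C = component_of (trail_undirectable_subgraph B r) v"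
proof -
  obtain v where v: "v \<in> gverts (trail_undirectable_subgraph B r)"
    "C = component_of (trail_undirectable_subgraph B r) v"
    using assms by (auto simp: trail_undirectable_components_def components_of_def)
  show thesis
  proof (rule that[OF v(1) _ _ v(2)])
    show "gverts C = {w \<in> gverts (trail_undirectable_subgraph B r). (v, w) \<in> adj\<^sup>*}"
      by (simp add: v(2) component_of_def connected_in_adj)
    have "gedges C = {e \<in> gedges (trail_undirectable_subgraph B r).
        gends (trail_undirectable_subgraph B r) e \<subseteq> gverts C}"
      by (simp add: v(2) component_of_def)
    then show "gedges C = {e \<in> gedges B. trail_undirectable B r e \<and> gends B e \<subseteq> gverts C}"
      unfolding trail_undirectable_subgraph_def by auto
  qed
qed

lemma undirectable_component_edge:
  assumes "C \<in> trail_undirectable_components B r" "e \<in> gedges C"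
  shows "e \<in> gedges B" "trail_undirectable B r e" "gends B e \<subseteq> gverts C"
proof -
  have "gedges C = {e \<in> gedges B. trail_undirectable B r e \<and> gends B e \<subseteq> gverts C}"
    by (rule undirectable_componentE[OF assms(1)])
  then show "e \<in> gedges B" "trail_undirectable B r e" "gends B e \<subseteq> gverts C"
    using assms(2) by auto
qed

text \<open>The edge is itself a step of \<open>adj\<close>, so its second end is connected to the
  first and lies in \<open>C\<close> too.\<close>

lemma undirectable_component_edgeI:
  assumes "C \<in> trail_undirectable_components B r" "e \<in> gedges B" "trail_undirectable B r e"
    "u \<in> gends B e" "u \<in> gverts C"
  shows "e \<in> gedges C"
proof -
  obtain v where v: "gverts C = {w \<in> gverts (trail_undirectable_subgraph B r). (v, w) \<in> adj\<^sup>*}"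
    "gedges C = {e \<in> gedges B. trail_undirectable B r e \<and> gends B e \<subseteq> gverts C}"
    by (rule undirectable_componentE[OF assms(1)])
  obtain a where a: "a \<in> oriented_edges B" "oedge a = e" "otail a = u"
    using orientation_from[OF assms(2,4)] .
  have ends: "gends B e = {u, ohead a}" using oriented_edgesD(2)[OF a(1)] a by simp
  have "(u, ohead a) \<in> adj"
    unfolding adj_iff using assms(2,3) ends by blast
  moreover have "(v, u) \<in> adj\<^sup>*" using assms(5) v(1) by simp
  ultimately have "(v, ohead a) \<in> adj\<^sup>*" by (rule rtrancl_into_rtrancl[rotated])
  moreover have "ohead a \<in> gverts (trail_undirectable_subgraph B r)"
    unfolding undirectable_subgraph_vert_iff using assms(2,3) ends by blast
  ultimately show ?thesis using v assms ends by auto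
qed

lemma undirectable_component_vert:
  assumes "C \<in> trail_undirectable_components B r" "v \<in> gverts C"
  obtains e where "e \<in> gedges C" "v \<in> gends B e"
proof -
  have "v \<in> gverts (trail_undirectable_subgraph B r)"
    by (rule undirectable_componentE[OF assms(1)]) (use assms(2) in simp)
  then obtain e where "e \<in> gedges B" "trail_undirectable B r e" "v \<in> gends B e"
    unfolding undirectable_subgraph_vert_iff by blast
  then show thesis using that undirectable_component_edgeI[OF assms(1)] assms(2) by blast
qed

lemma undirectable_component_unique:
  assumes "C \<in> trail_undirectable_components B r" "C' \<in> trail_undirectable_components B r"
    "v \<in> gverts C" "v \<in> gverts C'"
  shows "C = C'"
proof -
  obtain x where x: "gverts C = {w \<in> gverts (trail_undirectable_subgraph B r). (x, w) \<in> adj\<^sup>*}"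
    "C = component_of (trail_undirectable_subgraph B r) x"
    by (rule undirectable_componentE[OF assms(1)])
  obtain y where y: "gverts C' = {w \<in> gverts (trail_undirectable_subgraph B r). (y, w) \<in> adj\<^sup>*}"
    "C' = component_of (trail_undirectable_subgraph B r) y"
    by (rule undirectable_componentE[OF assms(2)])
  have "(x, v) \<in> adj\<^sup>*" "(y, v) \<in> adj\<^sup>*" using x(1) y(1) assms(3,4) by auto
  then have "(x, y) \<in> adj\<^sup>*" "(y, x) \<in> adj\<^sup>*"
    using sym_adj_rtrancl by (meson rtrancl_trans symD)+
  then have "(x, w) \<in> adj\<^sup>* \<longleftrightarrow> (y, w) \<in> adj\<^sup>*" for w
    by (meson rtrancl_trans)
  then show ?thesis unfolding x(2) y(2) component_of_def connected_in_adj by simp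
qed

text \<open>If no edge of \<open>C\<close> outside \<open>K\<close> met an edge of \<open>K\<close>,
  the vertices covered by \<open>K\<close> would be closed under \<open>adj\<close>. By
  connectedness they would be all of \<open>C\<close>, and any edge outside \<open>K\<close> would
  meet them after all.\<close>

lemma undirectable_component_boundary:
  assumes C: "C \<in> trail_undirectable_components B r"
    and K: "K \<subseteq> gedges C" "K \<noteq> {}" "K \<noteq> gedges C"
  obtains e e' v where "e \<in> gedges C - K" "e' \<in> K" "v \<in> gends B e" "v \<in> gends B e'"
proof -
  let ?U = "\<Union> (gends B ` K)"
  have "\<exists>e \<in> gedges C - K. gends B e \<inter> ?U \<noteq> {}"
  proof (rule ccontr)
    assume "\<not> ?thesis"
    then have no: "gends B e \<inter> ?U = {}" if "e \<in> gedges C - K" for e using that by blast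
    obtain x where x: "gverts C = {w \<in> gverts (trail_undirectable_subgraph B r). (x, w) \<in> adj\<^sup>*}"
      by (rule undirectable_componentE[OF C])
    have sub: "?U \<subseteq> gverts C" using undirectable_component_edge(3)[OF C] K(1) by blast
    obtain e0 where e0: "e0 \<in> K" using K(2) by auto
    have "gends B e0 \<noteq> {}" using card_ends[of e0] undirectable_component_edge(1)[OF C] e0 K(1) by auto
    then obtain u where u: "u \<in> ?U" using e0 by auto
    have step: "b \<in> ?U" if "(a, b) \<in> adj" "a \<in> ?U" for a b
    proof -
      obtain e where e: "e \<in> gedges B" "trail_undirectable B r e" "gends B e = {a, b}"
        using \<open>(a, b) \<in> adj\<close> unfolding adj_iff by blast
      then have "e \<in> gedges C"
        using undirectable_component_edgeI[OF C e(1,2)] that(2) sub by blast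
      then have "e \<in> K" using no[of e] e(3) that(2) by blast
      then show ?thesis using e(3) by auto
    qed
    have reach: "w \<in> ?U" if "(u, w) \<in> adj\<^sup>*" for w
      using that by (induction rule: rtrancl_induct) (use u step in blast)+
    obtain e where e: "e \<in> gedges C - K" using K by auto
    then have "gends B e \<noteq> {}" using card_ends[of e] undirectable_component_edge(1)[OF C] by auto
    then obtain w where w: "w \<in> gends B e" by auto
    then have "w \<in> gverts C" "u \<in> gverts C" using undirectable_component_edge(3)[OF C] e u sub by auto
    then have "(x, u) \<in> adj\<^sup>*" "(x, w) \<in> adj\<^sup>*" using x by auto
    then have "(u, w) \<in> adj\<^sup>*" using sym_adj_rtrancl by (meson rtrancl_trans symD)
    then show False using reach no[OF e] w by blast
  qed
  then show thesis using that by blast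
qed

end

section \<open>Blossoms behind an entering edge\<close>

text \<open>\<open>P @ [f]\<close> is the initial segment of a trail from the root up to its first
  entry into \<open>C\<close>. Since \<open>P\<close> stays away from \<open>C\<close>, it shares no
  edge with anything incident to \<open>C\<close>.\<close>

locale entered_component = finite_rooted_bidirected_graph B r
  for B :: "('v, 'e) bidirected" (structure) and r :: 'v +
  fixes C :: "('v, 'e) multigraph" and P :: "('v, 'e) oedge list" and f :: "('v, 'e) oedge"
  assumes component: "C \<in> trail_undirectable_components B r"
    and root_outside: "r \<notin> gverts C"
    and entry_trail: "linked_trail B (P @ [f])"
    and entry_start: "otail (hd (P @ [f])) = r"
    and entry_outside: "a \<in> set P \<Longrightarrow> otail a \<notin> gverts C \<and> ohead a \<notin> gverts C"
    and entry_tail: "otail f \<notin> gverts C"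
    and entry_head: "ohead f \<in> gverts C"
begin

lemma entry_oriented: "f \<in> oriented_edges B"
  using entry_trail by (simp add: linked_trail_append)

lemma entry_reached: "root_trail_to B r f"
  using root_trail_toI[OF root_in_verts entry_trail entry_start] .

lemma component_edge_ends:
  assumes "a \<in> oriented_edges B" "oedge a \<in> gedges C"
  shows "otail a \<in> gverts C" "ohead a \<in> gverts C"
  using undirectable_component_edge(3)[OF component assms(2)] oriented_edgesD(2)[OF assms(1)]
  by auto

lemma incident_undirectable:
  assumes "root_trail_to B r a" "root_trail_to B r (orev a)"
    "otail a \<in> gverts C \<or> ohead a \<in> gverts C"
  shows "oedge a \<in> gedges C"
proof -
  have a: "a \<in> oriented_edges B" using root_trail_to_oriented[OF assms(1)] .
  show ?thesis
    using undirectable_component_edgeI[OF component oriented_edgesD(1)[OF a]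
        trail_undirectableI[OF assms(1,2)]] assms(3) oriented_edgesD(2)[OF a] by auto
qed

lemma component_reached:
  assumes "a \<in> oriented_edges B" "oedge a \<in> gedges C"
  shows "root_trail_to B r a"
  using trail_undirectableD[OF undirectable_component_edge(2)[OF component assms(2)] assms(1)]
  by simp

lemma entry_notin: "oedge f \<notin> gedges C"
  using component_edge_ends(1)[OF entry_oriented] entry_tail by blast

text \<open>Each edge of \<open>q @ [a]\<close> has an end in \<open>C\<close>, while both ends of
  every edge of \<open>P\<close> lie outside, so \<open>P\<close> can be put in front without
  repeating an edge. The last edge \<open>a\<close> may leave \<open>C\<close>; the contradictions
  below come from such edges.\<close>

lemma reach_through_entry:
  assumes q: "linked_trail B (f # q @ [a])" "trail_edges q \<subseteq> gedges C"
  shows "root_trail_to B r a"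
proof -
  have inC: "otail b \<in> gverts C \<or> ohead b \<in> gverts C" if "b \<in> set (q @ [a])" for b
  proof (cases "b \<in> set q")
    case True
    then have "oedge b \<in> gedges C" using q(2) by (auto simp: trail_edges_def)
    moreover have "b \<in> oriented_edges B" using q(1) True by (auto simp: linked_trail_def)
    ultimately show ?thesis using component_edge_ends by blast
  next
    case False
    then have b: "b = a" using that by simp
    have "otail a = ohead (last (f # q))"
      using linked_trail_tail[of B "f # q" a "[]"] q(1) by simp
    moreover have "ohead (last (f # q)) \<in> gverts C"
    proof (cases "q = []")
      case False
      then have l: "last q \<in> set q" by simp
      then have "oedge (last q) \<in> gedges C" using q(2) unfolding trail_edges_def by blast
      moreover have "last q \<in> oriented_edges B" using q(1) l by (auto simp: linked_trail_def)
      ultimately show ?thesis using component_edge_ends(2) False by simp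
    qed (simp add: entry_head)
    ultimately show ?thesis using b by simp
  qed
  have disj: "trail_edges P \<inter> trail_edges (q @ [a]) = {}"
  proof (rule ccontr)
    assume "\<not> ?thesis"
    then obtain c b where cb: "c \<in> set P" "b \<in> set (q @ [a])" "oedge c = oedge b"
      unfolding trail_edges_def by blast
    then have "c \<in> oriented_edges B" "b \<in> oriented_edges B"
      using entry_trail q(1) by (auto simp: linked_trail_def)
    then have "c = b \<or> c = orev b" using same_edge_cases cb(3) by blast
    then show False using entry_outside[OF cb(1)] inC[OF cb(2)] by auto
  qed
  have "linked_trail B ((P @ [f]) @ (q @ [a]))"
    unfolding linked_trail_append[of B "P @ [f]" "q @ [a]"]
    using entry_trail q(1) disj by (auto simp: linked_trail_Cons)
  moreover have "otail (hd (((P @ [f]) @ q) @ [a])) = r"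
    using entry_start by (cases P) auto
  ultimately show ?thesis using root_trail_toI[OF root_in_verts, of "(P @ [f]) @ q" a] by simp
qed

section \<open>Blossoms and their growth\<close>

definition blossom :: "'e set \<Rightarrow> bool" where
  "blossom K \<longleftrightarrow> K \<subseteq> gedges C \<and>
    (\<forall>a \<in> oriented_edges B. oedge a \<in> K \<longrightarrow>
      (\<exists>p. linked_trail B (f # p @ [a]) \<and> trail_edges p \<subseteq> K))"

text \<open>Only incidence and signs are required at the end of a trail through \<open>f\<close> and
  \<open>K\<close>; the edge of \<open>a\<close> may already lie in \<open>K\<close>.
  Edge-disjointness is added in \<open>extend_continues\<close>.\<close>

definition continues :: "'e set \<Rightarrow> ('v, 'e) oedge \<Rightarrow> bool" where
  "continues K a \<longleftrightarrow>
    (\<exists>p. linked_trail B (f # p) \<and> trail_edges p \<subseteq> K \<and> consecutive B (last (f # p)) a)"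

lemma continues_entry: "consecutive B f a \<Longrightarrow> continues K a"
  unfolding continues_def using entry_oriented by (intro exI[of _ "[]"]) auto

text \<open>Let \<open>b\<close> be the orientation of \<open>e\<close> leaving the tail of
  \<open>a\<close>. If \<open>a\<close> and \<open>e\<close> have the same sign there, a trail about
  to use \<open>b\<close> can use \<open>a\<close> instead; if the signs differ, \<open>a\<close>
  can follow a trail that arrives by \<open>orev b\<close>.\<close>

lemma blossom_continues:
  assumes K: "blossom K" "e \<in> K" and a: "a \<in> oriented_edges B" "otail a \<in> gends B e"
  shows "continues K a"
proof -
  have "e \<in> gedges B" using K undirectable_component_edge(1)[OF component] by (auto simp: blossom_def)
  then obtain b where b: "b \<in> oriented_edges B" "oedge b = e" "otail b = otail a"
    using orientation_from a(2) by metis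
  show ?thesis
  proof (cases "half_sign B (oedge a) (otail a) = half_sign B e (otail a)")
    case True
    obtain p where p: "linked_trail B (f # p @ [b])" "trail_edges p \<subseteq> K"
      using K b(1,2) unfolding blossom_def by blast
    then have l: "linked_trail B (f # p)" "consecutive B (last (f # p)) b"
      using linked_trail_append[of B "f # p" "[b]"] by auto
    have "consecutive B (last (f # p)) a"
      using consecutive_same_half_sign[OF l(2)] b True by simp
    then show ?thesis unfolding continues_def using p(2) l(1) by blast
  next
    case False
    obtain p where p: "linked_trail B (f # p @ [orev b])" "trail_edges p \<subseteq> K"
      using K b(1,2) orev_simps(2) orev_oriented_edges unfolding blossom_def by metis
    have "consecutive B (orev b) a"
      using False b neq_opp_sign by (auto simp: consecutive_def)
    then show ?thesis
      unfolding continues_def using p K(2) b(2) by (intro exI[of _ "p @ [orev b]"]) auto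
  qed
qed

lemma extend_continues:
  assumes "continues K (hd (q @ [b]))" "linked_trail B (q @ [b])"
    "trail_edges (q @ [b]) \<inter> insert (oedge f) K = {}"
  obtains p where "linked_trail B (f # p @ q @ [b])" "trail_edges p \<subseteq> K"
proof -
  obtain p where p: "linked_trail B (f # p)" "trail_edges p \<subseteq> K"
    "consecutive B (last (f # p)) (hd (q @ [b]))"
    using assms(1) by (auto simp: continues_def)
  have "linked_trail B ((f # p) @ (q @ [b]))"
    unfolding linked_trail_append[of B "f # p" "q @ [b]"] using p assms(2,3) by auto
  then show thesis using that p(2) by simp
qed

text \<open>Both \<open>q\<close> and its reversal can be attached to \<open>K\<close>. Running
  along the ear one way reaches its edges in one orientation, running the other way in the opposite
  one.\<close>

lemma blossom_add_ear:
  assumes K: "blossom K" and q: "linked_trail B q" "q \<noteq> []" "trail_edges q \<subseteq> gedges C - K"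
    and ends: "continues K (hd q)" "continues K (orev (last q))"
  shows "blossom (K \<union> trail_edges q)"
proof -
  \<comment> \<open>The trail is quantified anew because the claim is applied to \<open>q\<close>
    and to its reversal.\<close>
  have ear: "\<exists>p. linked_trail B (f # p @ [b]) \<and> trail_edges p \<subseteq> K \<union> trail_edges q"
    if q: "linked_trail B q" "trail_edges q \<subseteq> gedges C - K" "continues K (hd q)" "b \<in> set q"
    for q b
  proof -
    obtain q1 q2 where q12: "q = q1 @ b # q2" using q(4) by (meson split_list)
    have "linked_trail B (q1 @ [b])" using q(1) q12 by (auto simp: linked_trail_append linked_trail_Cons)
    moreover have "continues K (hd (q1 @ [b]))" using q(3) q12 by (cases q1) auto
    moreover have "trail_edges (q1 @ [b]) \<inter> insert (oedge f) K = {}"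
      using q(2) q12 entry_notin by auto
    ultimately obtain p where "linked_trail B (f # p @ q1 @ [b])" "trail_edges p \<subseteq> K"
      using extend_continues by blast
    then show ?thesis using q12 by (intro exI[of _ "p @ q1"]) auto
  qed
  have "\<exists>p. linked_trail B (f # p @ [a]) \<and> trail_edges p \<subseteq> K \<union> trail_edges q"
    if a: "a \<in> oriented_edges B" "oedge a \<in> K \<union> trail_edges q" for a
  proof (cases "oedge a \<in> K")
    case True
    then show ?thesis using K a(1) unfolding blossom_def by blast
  next
    case False
    then obtain b where b: "b \<in> set q" "oedge b = oedge a" using a(2) by (auto simp: trail_edges_def)
    then have bo: "b \<in> oriented_edges B" using q(1) by (auto simp: linked_trail_def)
    then consider "a = b" | "a = orev b" using same_edge_cases[OF a(1) bo] b(2) by auto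
    then show ?thesis
    proof cases
      case 1
      then show ?thesis using ear[OF q(1,3) ends(1)] b(1) by blast
    next
      case 2
      then have "a \<in> set (rev (map orev q))" using b(1) by auto
      moreover have "hd (rev (map orev q)) = orev (last q)" using q(2) by (simp add: hd_rev last_map)
      ultimately show ?thesis
        using ear[OF linked_trail_rev[OF q(1)], of a] q(3) ends(2) by simp
    qed
  qed
  then show ?thesis using K q(3) unfolding blossom_def by blast
qed

text \<open>A trail from the root to \<open>orev a\<close>, followed backwards from its end, starts
  with \<open>a\<close> and so leaves \<open>K\<close>. It either returns to a place attachable to
  \<open>K\<close>, giving an ear, or leaves \<open>C\<close> first, which is impossible.\<close>

lemma blossom_grows:
  assumes K: "blossom K" and a: "a \<in> oriented_edges B" "oedge a \<in> gedges C - K" "continues K a"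
  obtains K' where "blossom K'" "K \<subset> K'"
proof -
  have "root_trail_to B r (orev a)" using component_reached[of "orev a"] a by simp
  then obtain Q where Q: "linked_trail B (Q @ [orev a])" "otail (hd (Q @ [orev a])) = r"
    by (rule root_trail_toE)
  let ?Q = "Q @ [orev a]"
  \<comment> \<open>The last stopping edge on the trail to \<open>orev a\<close> is where the
    backward run ends: it lies outside \<open>C\<close> or can itself continue
    \<open>K\<close>.\<close>
  let ?stop = "\<lambda>x. oedge x \<notin> gedges C \<or> continues K x"
  have oriented: "set ?Q \<subseteq> oriented_edges B" using Q(1) by (simp add: linked_trail_def)
  have "hd ?Q \<in> oriented_edges B" using oriented by (cases Q) auto
  \<comment> \<open>The first edge leaves the root, which is outside \<open>C\<close>, so a stopping
    edge exists.\<close>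
  then have "?stop (hd ?Q)" using component_edge_ends(1) Q(2) root_outside by metis
  moreover have "hd ?Q \<in> set ?Q" by (cases Q) auto
  ultimately have "\<exists>x\<in>set ?Q. ?stop x" by blast
  from split_list_last_prop[OF this]
  obtain Q0 x Q1 where Q01: "?Q = Q0 @ x # Q1" "?stop x" "\<forall>y\<in>set Q1. \<not> ?stop y" by blast
  have l: "linked_trail B (x # Q1)" using Q(1) unfolding Q01(1) linked_trail_append by blast
  have last: "last (x # Q1) = orev a" using Q01(1) by (metis last_appendR last_snoc list.discI)
  have x: "x \<in> oriented_edges B" "root_trail_to B r x"
  proof -
    show "x \<in> oriented_edges B" using oriented Q01(1) by auto
    have "linked_trail B (Q0 @ [x])" using Q(1) unfolding Q01(1)
      by (auto simp: linked_trail_append linked_trail_Cons)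
    moreover have "hd (Q0 @ [x]) = hd ?Q" unfolding Q01(1) by (cases Q0) auto
    ultimately show "root_trail_to B r x" using root_trail_toI[OF root_in_verts] Q(2) by metis
  qed
  have Q1_oriented: "set Q1 \<subseteq> oriented_edges B" using l by (simp add: linked_trail_def)
  \<comment> \<open>An edge of \<open>K\<close> would itself continue \<open>K\<close> by
    \<open>blossom_continues\<close>, hence be a stopping edge.\<close>
  have Q1: "trail_edges Q1 \<subseteq> gedges C - K"
  proof -
    have "oedge y \<in> gedges C - K" if "y \<in> set Q1" for y
    proof -
      have y: "y \<in> oriented_edges B" using Q1_oriented that by blast
      have "oedge y \<in> gedges C" "\<not> continues K y" using Q01(3) that by auto
      moreover have "otail y \<in> gends B (oedge y)" using oriented_edgesD(2)[OF y] by simp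
      ultimately show ?thesis using blossom_continues[OF K _ y] by blast
    qed
    then show ?thesis by (auto simp: trail_edges_def)
  qed
  have x_head: "Q1 \<noteq> [] \<Longrightarrow> consecutive B x (hd Q1)" using l by (simp add: linked_trail_Cons)
  show thesis
  proof (cases "oedge x \<in> gedges C")
    case True
    \<comment> \<open>If \<open>x\<close> lay in \<open>K\<close> and had a successor, that
      successor would start at an end of an edge of \<open>K\<close> and be a later stopping edge.
      Without a successor, \<open>x\<close> is \<open>orev a\<close>.\<close>
    have "oedge x \<notin> K"
    proof (cases "Q1 = []")
      case True
      then show ?thesis using last a(2) by simp
    next
      case False
      then have h: "hd Q1 \<in> set Q1" "hd Q1 \<in> oriented_edges B" using Q1_oriented by auto
      have "otail (hd Q1) \<in> gends B (oedge x)"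
        using x_head[OF False] oriented_edgesD(2)[OF x(1)] by (simp add: consecutive_def)
      then show ?thesis using blossom_continues[OF K _ h(2)] Q01(3) h(1) by blast
    qed
    \<comment> \<open>Here \<open>x\<close> continues \<open>K\<close> by the stopping condition,
      and the reversed ear starts with \<open>a\<close>.\<close>
    then have "blossom (K \<union> trail_edges (x # Q1))"
      using Q1 True last a(3) Q01(2) by (intro blossom_add_ear[OF K l]) auto
    moreover have "oedge a \<in> trail_edges (x # Q1)"
    proof -
      have "orev a \<in> set (x # Q1)" using last last_in_set[of "x # Q1"] by simp
      then have "oedge (orev a) \<in> trail_edges (x # Q1)" unfolding trail_edges_def by blast
      then show ?thesis by simp
    qed
    ultimately show thesis using that a(2) by blast
  next
    case False
    then have ne: "Q1 \<noteq> []" using last a(2) by auto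
    then have h: "hd Q1 \<in> set Q1" by simp
    then have "ohead x \<in> gverts C"
      using x_head[OF ne] component_edge_ends(1)[of "hd Q1"] Q1_oriented Q1
      by (auto simp: consecutive_def trail_edges_def)
    have not_rev: "\<not> root_trail_to B r (orev x)"
      using incident_undirectable[OF x(2)] \<open>ohead x \<in> gverts C\<close> False by blast
    \<comment> \<open>If \<open>x = f\<close>, the edge after it would continue \<open>K\<close> and
      be a later stopping edge; if \<open>x = orev f\<close>, then \<open>orev x = f\<close> is
      reached, against \<open>not_rev\<close>.\<close>
    have "oedge x \<noteq> oedge f"
    proof
      assume "oedge x = oedge f"
      then consider "x = f" | "x = orev f" using same_edge_cases[OF x(1) entry_oriented] by blast
      then show False
      proof cases
        case 1
        then show False using continues_entry x_head[OF ne] Q01(3) h by blast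
      next
        case 2
        then show False using entry_reached not_rev by simp
      qed
    qed
    \<comment> \<open>Going through \<open>f\<close> and \<open>K\<close>, then backwards along
      \<open>Q1\<close>, reaches \<open>orev x\<close>. Thus \<open>x\<close>, which enters
      \<open>C\<close>, would be undirectable and belong to \<open>C\<close>.\<close>
    let ?q = "rev (map orev Q1)"
    have "linked_trail B (?q @ [orev x])" using linked_trail_rev[OF l] by simp
    moreover have "hd (?q @ [orev x]) = a"
      using last ne by (simp add: hd_append hd_rev last_map)
    moreover have "trail_edges (?q @ [orev x]) \<inter> insert (oedge f) K = {}"
      using Q1 False entry_notin \<open>oedge x \<noteq> oedge f\<close> K by (auto simp: blossom_def)
    ultimately obtain p where p: "linked_trail B (f # p @ ?q @ [orev x])" "trail_edges p \<subseteq> K"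
      using extend_continues a(3) by metis
    have "root_trail_to B r (orev x)"
      using reach_through_entry[of "p @ ?q" "orev x"] p Q1 K by (auto simp: blossom_def)
    then show thesis using not_rev by blast
  qed
qed

text \<open>The starting edge for the empty blossom. If an edge \<open>a\<close> of \<open>C\<close>
  at the head of \<open>f\<close> has the wrong sign, the predecessor \<open>h\<close> of
  \<open>a\<close> on a trail from the root has the right one, and \<open>orev h\<close> serves
  instead.\<close>

lemma continues_at_entry:
  obtains a where "a \<in> oriented_edges B" "oedge a \<in> gedges C" "continues {} a"
proof -
  obtain e where e: "e \<in> gedges C" "ohead f \<in> gends B e"
    using undirectable_component_vert[OF component entry_head] .
  obtain a where a: "a \<in> oriented_edges B" "oedge a = e" "otail a = ohead f"
    using orientation_from[OF undirectable_component_edge(1)[OF component e(1)] e(2)] .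
  show thesis
  proof (cases "consecutive B f a")
    case True
    then show thesis using that a e continues_entry by blast
  next
    case False
    then have sign: "half_sign B (oedge a) (ohead f) = half_sign B (oedge f) (ohead f)"
      using a(3) neq_opp_sign by (auto simp: consecutive_def)
    have "root_trail_to B r a" using component_reached[OF a(1)] a(2) e(1) by simp
    then obtain p where p: "linked_trail B (p @ [a])" "otail (hd (p @ [a])) = r"
      by (rule root_trail_toE)
    \<comment> \<open>Otherwise \<open>a\<close> would start at the root, but its tail is in
      \<open>C\<close>.\<close>
    have "p \<noteq> []" using p(2) a(3) entry_head root_outside by auto
    then obtain p' h where h: "p = p' @ [h]" by (meson rev_exhaust)
    have "root_trail_to B r h"
    proof (rule root_trail_toI[OF root_in_verts])
      show "linked_trail B (p' @ [h])" using p(1) h by (simp add: linked_trail_append linked_trail_Cons)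
      show "otail (hd (p' @ [h])) = r" using p(2) h by (cases p') auto
    qed
    have c: "consecutive B h a" using p(1) h by (simp add: linked_trail_append linked_trail_Cons)
    \<comment> \<open>At the head of \<open>f\<close>, the sign of \<open>h\<close> is opposite to
      that of \<open>a\<close>, which equals that of \<open>f\<close>.\<close>
    then have fh: "consecutive B f (orev h)"
      using sign a(3) opp_sign_opp_sign unfolding consecutive_def orev_simps by metis
    \<comment> \<open>The two edges have opposite signs at the same vertex.\<close>
    have "oedge h \<noteq> oedge f" using c a(3) sign by (auto simp: consecutive_def)
    then have "linked_trail B [f, orev h]"
      using fh entry_oriented root_trail_to_oriented[OF \<open>root_trail_to B r h\<close>]
      by (auto simp: linked_trail_Cons)
    then have "root_trail_to B r (orev h)" using reach_through_entry[of "[]" "orev h"] by simp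
    moreover have "ohead h \<in> gverts C" using c a(3) entry_head by (simp add: consecutive_def)
    ultimately have "oedge h \<in> gedges C"
      using incident_undirectable[OF \<open>root_trail_to B r h\<close>] by blast
    then show thesis
      using that[of "orev h"] root_trail_to_oriented[OF \<open>root_trail_to B r h\<close>] fh continues_entry by simp
  qed
qed

lemma component_blossom: "blossom (gedges C)"
proof -
  have "finite (gedges C)"
    using finite_edges undirectable_component_edge(1)[OF component] by (meson finite_subset subsetI)
  then have "finite {K. blossom K}"
    by (rule finite_subset[rotated, OF finite_Pow_iff[THEN iffD2]]) (auto simp: blossom_def)
  moreover have "blossom {}" by (simp add: blossom_def)
  ultimately obtain K where K: "blossom K" "\<And>K'. blossom K' \<Longrightarrow> K \<subseteq> K' \<Longrightarrow> K = K'"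
    using finite_has_maximal[of "{K. blossom K}"] by blast
  have "K = gedges C"
  proof (rule ccontr)
    assume ne: "K \<noteq> gedges C"
    have "\<exists>a \<in> oriented_edges B. oedge a \<in> gedges C - K \<and> continues K a"
    \<comment> \<open>The boundary argument needs an edge in \<open>K\<close>; the empty blossom is
      left through \<open>f\<close> directly.\<close>
    proof (cases "K = {}")
      case True
      then show ?thesis using continues_at_entry by blast
    next
      case False
      have "K \<subseteq> gedges C" using K(1) by (simp add: blossom_def)
      from undirectable_component_boundary[OF component this False ne]
      obtain e e' v where e: "e \<in> gedges C - K" "e' \<in> K" "v \<in> gends B e" "v \<in> gends B e'" .
      obtain a where "a \<in> oriented_edges B" "oedge a = e" "otail a = v"
        using orientation_from[OF undirectable_component_edge(1)[OF component] e(3)] e(1) by auto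
      then show ?thesis using blossom_continues[OF K(1) e(2)] e(1,4) by blast
    qed
    then show False using blossom_grows[OF K(1)] K(2) by blast
  qed
  then show ?thesis using K(1) by simp
qed

section \<open>Consequences: \<open>f\<close> is the only entrance\<close>

text \<open>As all of \<open>C\<close> is a blossom, a trail through \<open>f\<close> and
  \<open>C\<close> can leave by \<open>orev g\<close> for any other entering edge \<open>g\<close>.
  Then \<open>g\<close> is reached both ways and would belong to \<open>C\<close>.\<close>

lemma entering_edge_unique:
  assumes g: "root_trail_to B r g" "ohead g \<in> gverts C" "oedge g \<notin> gedges C"
  shows "g = f"
proof (rule ccontr)
  assume "g \<noteq> f"
  have o: "g \<in> oriented_edges B" using root_trail_to_oriented[OF g(1)] .
  have not_rev: "\<not> root_trail_to B r (orev g)"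
    using incident_undirectable[OF g(1)] g(2,3) by blast
  then have "oedge g \<noteq> oedge f"
    using same_edge_cases[OF o entry_oriented] \<open>g \<noteq> f\<close> entry_reached by auto
  obtain e where e: "e \<in> gedges C" "ohead g \<in> gends B e"
    using undirectable_component_vert[OF component g(2)] .
  then have "continues (gedges C) (orev g)"
    using blossom_continues[OF component_blossom e(1), of "orev g"] o by simp
  then obtain p where "linked_trail B (f # p @ [] @ [orev g])" "trail_edges p \<subseteq> gedges C"
    using extend_continues[of "gedges C" "[]" "orev g"] o g(3) \<open>oedge g \<noteq> oedge f\<close> by auto
  then show False using reach_through_entry[of p "orev g"] not_rev by simp
qed

lemma trail_contains_entry:
  assumes p: "bi_trail B r p x" and x: "x \<in> gverts C"
  shows "f \<in> set p"
proof -
  note p = bi_trail_linked[OF p]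
  have ne: "p \<noteq> []" using p(4) x root_outside by auto
  obtain p1 g p2 where g: "p = p1 @ g # p2" "ohead g \<in> gverts C" "otail g \<notin> gverts C"
    using linked_trail_first_entry[OF p(1) ne, of "gverts C"] p(2,3)[OF ne] root_outside x
    by metis
  have "root_trail_to B r g"
  proof (rule root_trail_toI[OF root_in_verts])
    show l: "linked_trail B (p1 @ [g])"
      using p(1) g(1) by (simp add: linked_trail_append linked_trail_Cons)
    show "otail (hd (p1 @ [g])) = r" using p(2)[OF ne] g(1) by (cases p1) auto
  qed
  \<comment> \<open>At its first entry the trail uses an edge with tail outside \<open>C\<close>,
    whereas edges of \<open>C\<close> have both ends inside.\<close>
  moreover from this have "oedge g \<notin> gedges C"
    using component_edge_ends(1)[OF root_trail_to_oriented] g(3) by blast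
  ultimately have "g = f" using entering_edge_unique g(2) by blast
  then show ?thesis using g(1) by simp
qed

lemma entry_directable:
  "trail_directable B r (oedge f)" "natural_orientation B r (oedge f) = f"
proof -
  have "\<not> trail_undirectable B r (oedge f)"
    using undirectable_component_edgeI[OF component oriented_edgesD(1)[OF entry_oriented]]
      oriented_edgesD(2)[OF entry_oriented] entry_head entry_notin by blast
  then show "trail_directable B r (oedge f)" "natural_orientation B r (oedge f) = f"
    using natural_orientation_eq[OF entry_reached] by auto
qed

lemma directable_entering_edge:
  assumes "trail_directable B r e" "ohead (natural_orientation B r e) \<in> gverts C"
  shows "e = oedge f"
proof -
  note e = trail_directableD[OF assms(1)]
  have "e \<notin> gedges C" using e(3) undirectable_component_edge(2)[OF component] by blast
  then show ?thesis using entering_edge_unique[OF e(1) assms(2)] e(2) by simp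
qed

lemma component_vertex_eq: "component_vertex B r C = ohead f"
proof -
  have "entry_edge B r C = oedge f"
    unfolding entry_edge_def
  proof (rule the_equality)
    show "oedge f \<in> gedges B \<and> trail_directable B r (oedge f) \<and>
        ohead (natural_orientation B r (oedge f)) \<in> gverts C"
      using entry_directable entry_head oriented_edgesD(1)[OF entry_oriented] by simp
  qed (simp add: directable_entering_edge)
  then show ?thesis using root_outside entry_directable(2) by (simp add: component_vertex_def)
qed

end

section \<open>The trail-skeleton\<close>

context finite_rooted_bidirected_graph
begin

text \<open>An edge of \<open>C\<close> at \<open>x\<close> is undirectable, so it is also reached
  in the orientation towards \<open>x\<close>. Cutting that trail at its first entry into
  \<open>C\<close> gives \<open>P\<close> and \<open>f\<close>; the whole trail is returned to show
  that \<open>x\<close> can be reached.\<close>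

lemma entered_component_exists:
  assumes C: "C \<in> trail_undirectable_components B r" and "r \<notin> gverts C" "x \<in> gverts C"
  obtains P f p where "entered_component B r C P f" "bi_trail B r p x"
proof -
  obtain e where e: "e \<in> gedges C" "x \<in> gends B e"
    using undirectable_component_vert[OF C assms(3)] .
  obtain b where b: "b \<in> oriented_edges B" "oedge b = e" "otail b = x"
    using orientation_from[OF undirectable_component_edge(1)[OF C e(1)] e(2)] .
  have "root_trail_to B r (orev b)"
    using trail_undirectableD[OF undirectable_component_edge(2)[OF C e(1)], of "orev b"] b by simp
  then obtain p where p: "linked_trail B (p @ [orev b])" "otail (hd (p @ [orev b])) = r"
    by (rule root_trail_toE)
  have trail: "bi_trail B r (p @ [orev b]) x"
    using bi_trailI[OF root_in_verts p(1) _ p(2)] b(3) by simp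
  have "p @ [orev b] \<noteq> []" "otail (hd (p @ [orev b])) \<notin> gverts C"
    "ohead (last (p @ [orev b])) \<in> gverts C"
    using p(2) b(3) assms(2,3) by simp_all
  from linked_trail_first_entry[OF p(1) this]
  obtain P f p2 where f: "p @ [orev b] = P @ f # p2" "ohead f \<in> gverts C" "otail f \<notin> gverts C"
    "\<And>a. a \<in> set P \<Longrightarrow> otail a \<notin> gverts C \<and> ohead a \<notin> gverts C" by blast
  have "linked_trail B (P @ [f])"
    using p(1) unfolding f(1) by (simp add: linked_trail_append linked_trail_Cons)
  moreover have "otail (hd (P @ [f])) = r" using p(2) unfolding f(1) by (cases P) auto
  ultimately have "entered_component B r C P f"
    using C assms(2) f(2-4) by unfold_locales auto
  then show thesis using that trail by blast
qed

lemma component_vertex_in: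
  assumes "C \<in> trail_undirectable_components B r"
  shows "component_vertex B r C \<in> gverts C"
proof (cases "r \<in> gverts C")
  case False
  obtain e where "e \<in> gedges C" using assms by (auto simp: trail_undirectable_components_def)
  then have "gends B e \<subseteq> gverts C" "card (gends B e) = 2"
    using undirectable_component_edge[OF assms] card_ends by auto
  then obtain x where "x \<in> gverts C" by fastforce
  then obtain P f p where "entered_component B r C P f"
    using entered_component_exists[OF assms False] by metis
  then interpret entered_component B r C P f .
  show ?thesis using component_vertex_eq entry_head by simp
qed (simp add: component_vertex_def)

lemma skeleton_proj_component:
  assumes "C \<in> trail_undirectable_components B r" "w \<in> gverts C"
  shows "skeleton_proj B r w = component_vertex B r C"
proof -
  have "(THE C. C \<in> trail_undirectable_components B r \<and> w \<in> gverts C) = C"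
    using assms undirectable_component_unique[OF _ assms(1) _ assms(2)]
    by (intro the_equality) blast+
  then show ?thesis using assms by (auto simp: skeleton_proj_def)
qed

text \<open>Each component contains its own vertex, so distinct components, being disjoint, have
  distinct vertices. A vertex outside all components is projected to itself and cannot be the vertex
  of \<open>C\<close>.\<close>

lemma skeleton_proj_eqD:
  assumes C: "C \<in> trail_undirectable_components B r"
    and w: "skeleton_proj B r w = component_vertex B r C"
  shows "w \<in> gverts C"
proof (cases "\<exists>C' \<in> trail_undirectable_components B r. w \<in> gverts C'")
  case True
  then obtain C' where C': "C' \<in> trail_undirectable_components B r" "w \<in> gverts C'" by blast
  then have "component_vertex B r C' = component_vertex B r C"
    using skeleton_proj_component w by simp
  then have "C' = C"
    using undirectable_component_unique[OF C'(1) C component_vertex_in[OF C'(1)]]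
      component_vertex_in[OF C] by simp
  then show ?thesis using C' by simp
next
  case False
  then have "w = component_vertex B r C" using w by (simp add: skeleton_proj_def)
  then show ?thesis using component_vertex_in[OF C] by simp
qed

lemma undirectable_edge_component:
  assumes "e \<in> gedges B" "trail_undirectable B r e"
  obtains C where "C \<in> trail_undirectable_components B r" "e \<in> gedges C"
proof -
  let ?S = "trail_undirectable_subgraph B r"
  obtain x y where xy: "gends B e = {x, y}"
    using card_ends[OF assms(1)] by (auto simp: card_2_iff)
  have verts: "x \<in> gverts ?S" "y \<in> gverts ?S"
    unfolding undirectable_subgraph_vert_iff using assms xy by blast+
  have "(x, y) \<in> adj" unfolding adj_iff using assms xy by blast
  then have "(x, y) \<in> adj\<^sup>*" by blast
  then have "e \<in> gedges (component_of ?S x)"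
    using assms xy verts
    by (simp add: component_of_def connected_in_adj)
      (simp add: trail_undirectable_subgraph_def)
  moreover from this have "component_of ?S x \<in> trail_undirectable_components B r"
    using verts by (auto simp: trail_undirectable_components_def components_of_def)
  ultimately show thesis using that by blast
qed

lemma wf_trail_skeleton: "wf_digraph (trail_skeleton B r)"
proof
  fix e assume "e \<in> arcs (trail_skeleton B r)"
  then have "trail_directable B r e" by (simp add: trail_skeleton_def)
  from oriented_edgesD(4,5)[OF root_trail_to_oriented[OF trail_directableD(1)[OF this]]]
  show "tail (trail_skeleton B r) e \<in> verts (trail_skeleton B r)"
    "head (trail_skeleton B r) e \<in> verts (trail_skeleton B r)"
    by (simp_all add: trail_skeleton_def)
qed

text \<open>Projecting a trail from the root edge by edge: undirectable edges collapse to a point,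
  and directable ones become arcs of the skeleton.\<close>

lemma skeleton_awalk:
  assumes "edge_clean B r" "linked_trail B p" "p \<noteq> [] \<Longrightarrow> otail (hd p) = r"
  shows "\<exists>q. pre_digraph.awalk (trail_skeleton B r) r q (skeleton_proj B r (last (r # map ohead p)))"
  using assms(2,3)
proof (induction p rule: rev_induct)
  interpret D: wf_digraph "trail_skeleton B r" by (rule wf_trail_skeleton)
  \<comment> \<open>By edge-cleanness the root lies in no component, so the projection fixes
    it.\<close>
  have root: "skeleton_proj B r r = r"
    using assms(1) by (auto simp: skeleton_proj_def edge_clean_def)
  case Nil
  have "r \<in> verts (trail_skeleton B r)"
    using root root_in_verts by (auto simp: trail_skeleton_def intro: image_eqI[of _ _ r])
  then show ?case using root D.awalk_Nil_iff by auto
next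
  case (snoc a p)
  interpret D: wf_digraph "trail_skeleton B r" by (rule wf_trail_skeleton)
  have "linked_trail B p" "p \<noteq> [] \<Longrightarrow> otail (hd p) = r"
    using snoc.prems by (auto simp: linked_trail_append)
  from snoc.IH[OF this] obtain q
    where "D.awalk r q (skeleton_proj B r (last (r # map ohead p)))" by blast
  moreover have "last (r # map ohead p) = otail a"
    using linked_trail_tail[of B p a "[]"] snoc.prems by (auto simp: last_map)
  ultimately have q: "D.awalk r q (skeleton_proj B r (otail a))" by simp
  \<comment> \<open>The trail itself witnesses that \<open>a\<close> is reached; if its edge is
    directable, it is therefore traversed in its natural orientation.\<close>
  have a: "root_trail_to B r a"
    using root_trail_toI[OF root_in_verts snoc.prems(1)] snoc.prems(2) by simp
  have ao: "oedge a \<in> gedges B" "gends B (oedge a) = {otail a, ohead a}"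
    using oriented_edgesD[OF root_trail_to_oriented[OF a]] by auto
  show ?case
  proof (cases "trail_undirectable B r (oedge a)")
    case True
    obtain C where C: "C \<in> trail_undirectable_components B r" "oedge a \<in> gedges C"
      using undirectable_edge_component[OF ao(1) True] .
    then have "otail a \<in> gverts C" "ohead a \<in> gverts C"
      using undirectable_component_edge(3) ao(2) by auto
    then have "skeleton_proj B r (otail a) = skeleton_proj B r (ohead a)"
      using skeleton_proj_component[OF C(1)] by simp
    then show ?thesis using q by auto
  next
    case False
    note nat = natural_orientation_eq[OF a False]
    have "oedge a \<in> arcs (trail_skeleton B r)" using nat ao(1) by (simp add: trail_skeleton_def)
    from D.arc_implies_awalk[OF this]
    have "D.awalk (skeleton_proj B r (otail a)) [oedge a] (skeleton_proj B r (ohead a))"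
      using nat(2) by (simp add: trail_skeleton_def)
    from D.awalk_appendI[OF q this]
    have "\<exists>q. D.awalk r q (skeleton_proj B r (ohead a))" by (rule exI)
    then show ?thesis by simp
  qed
qed

end

section \<open>Counting disjoint trails and the conclusion\<close>

text \<open>The common element \<open>x\<close> keeps any two members from being disjoint, so a
  disjoint family has at most one member; \<open>{p}\<close> attains this.\<close>

lemma max_disjoint_eq_1:
  assumes "p \<in> S" "\<And>q. q \<in> S \<Longrightarrow> x \<in> E q"
  shows "max_disjoint E S = 1"
proof -
  let ?F = "{P. P \<subseteq> S \<and> pairwise (\<lambda>p q. disjnt (E p) (E q)) P}"
  have cases: "P = {} \<or> (\<exists>q. P = {q})" if "P \<in> ?F" for P
  proof -
    have "q = q'" if q: "q \<in> P" "q' \<in> P" for q q'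
    proof -
      have "x \<in> E q" "x \<in> E q'" using q \<open>P \<in> ?F\<close> assms(2) by blast+
      then have "\<not> disjnt (E q) (E q')" by (auto simp: disjnt_iff)
      then show ?thesis using q \<open>P \<in> ?F\<close> unfolding pairwise_def by blast
    qed
    then show ?thesis by blast
  qed
  have "card P \<in> {0, 1}" if "P \<in> ?F" for P using cases[OF that] by auto
  then have "card ` ?F \<subseteq> {0, 1}" by (rule image_subsetI)
  moreover have "{} \<in> ?F" "{p} \<in> ?F" using assms(1) by (auto simp: pairwise_def)
  from this[THEN imageI[of _ _ card]] have "{0, 1} \<subseteq> card ` ?F" by simp
  \<comment> \<open>The set of cardinalities is exactly \<open>{0, 1}\<close>, finite and nonempty,
    so \<open>Max\<close> is a true maximum.\<close>
  ultimately have "card ` ?F = {0, 1}" by (rule subset_antisym)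
  then show ?thesis by (simp add: max_disjoint_def)
qed

theorem lemma3p14:
  fixes B :: "('v, 'e) bidirected" and r :: 'v and C :: "('v, 'e) multigraph"
  assumes "finite_rooted_bidirected_graph B r"
    and "edge_clean B r"
    and "trail_reachable B r"
    and "C \<in> trail_undirectable_components B r"
  shows "lambda_digraph (trail_skeleton B r) r (component_vertex B r C) = 1 \<and>
    (\<forall>x \<in> gverts C. lambda_trail B r x = 1) \<and>
    (path_reachable B r \<longrightarrow> (\<forall>x \<in> gverts C. lambda_path B r x = 1))"
proof -
  interpret finite_rooted_bidirected_graph B r by fact
  note C = assms(4)
  have r: "r \<notin> gverts C" using assms(2) C by (auto simp: edge_clean_def)
  obtain P f p0 where "entered_component B r C P f"
    using entered_component_exists[OF C r component_vertex_in[OF C]] .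
  then interpret entered_component B r C P f .
  have entry_in: "oedge f \<in> trail_edges p" if "bi_trail B r p x" "x \<in> gverts C" for p x
    using trail_contains_entry[OF that] by (auto simp: trail_edges_def)
  have "lambda_digraph (trail_skeleton B r) r (component_vertex B r C) = 1"
  proof -
    interpret D: wf_digraph "trail_skeleton B r" by (rule wf_trail_skeleton)
    let ?c = "component_vertex B r C"
    obtain q where "D.awalk r q (skeleton_proj B r (last (r # map ohead (P @ [f]))))"
      using skeleton_awalk[OF assms(2) entry_trail] entry_start by blast
    then have "D.awalk r q ?c"
      using skeleton_proj_component[OF C entry_head] by simp
    then have "D.awalk_to_apath q \<in> {p. D.apath r p ?c}" using D.apath_awalk_to_apath by simp
    moreover have "oedge f \<in> set p" if "p \<in> {p. D.apath r p ?c}" for p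
    proof -
      have p: "D.awalk r p ?c" using that D.awalkI_apath by simp
      \<comment> \<open>The target lies in \<open>C\<close> and the root does not.\<close>
      then have "p \<noteq> []" using D.awalk_Nil_iff component_vertex_in[OF C] r by auto
      then obtain p' e where e: "p = p' @ [e]" by (meson rev_exhaust)
      then have "D.awalk (D.awlast r p') [e] ?c" using p by simp
      then have arc: "e \<in> arcs (trail_skeleton B r)" "head (trail_skeleton B r) e = ?c"
        by (auto simp: D.awalk_Cons_iff D.awalk_Nil_iff)
      then have "trail_directable B r e"
        "skeleton_proj B r (ohead (natural_orientation B r e)) = ?c"
        by (simp_all add: trail_skeleton_def)
      \<comment> \<open>The last arc ends at the vertex of \<open>C\<close>, so the natural head of
        its edge lies in \<open>C\<close>; the only such directable edge is that of
        \<open>f\<close>.\<close>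
      then show ?thesis using directable_entering_edge skeleton_proj_eqD[OF C] e by simp
    qed
    ultimately show ?thesis unfolding lambda_digraph_def by (rule max_disjoint_eq_1)
  qed
  moreover have "lambda_trail B r x = 1" if x: "x \<in> gverts C" for x
  proof -
    \<comment> \<open>This provides one trail to \<open>x\<close>; the edge shared by all trails to
      \<open>x\<close> is that of the fixed \<open>f\<close>.\<close>
    obtain P' f' p where "entered_component B r C P' f'" "bi_trail B r p x"
      using entered_component_exists[OF C r x] .
    then show ?thesis unfolding lambda_trail_def
      by (intro max_disjoint_eq_1[of p _ "oedge f"]) (use entry_in x in auto)
  qed
  moreover have "lambda_path B r x = 1" if pr: "path_reachable B r" and x: "x \<in> gverts C" for x
  proof -
    obtain e where e: "e \<in> gedges C" "x \<in> gends B e"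
      using undirectable_component_vert[OF C x] .
    obtain a where "oedge a = e" "root_path_to B r a"
      using pr undirectable_component_edge(1)[OF C e(1)] by (auto simp: path_reachable_def)
    then obtain p w where p: "bi_path B r p w" "p \<noteq> []" "oedge (last p) = e"
      by (auto simp: root_path_to_def)
    note lp = bi_trail_linked[OF p(1)[unfolded bi_path_def, THEN conjunct1]]
    have "last p \<in> oriented_edges B" using lp(1) p(2) by (auto simp: linked_trail_def)
    then consider "x = ohead (last p)" | "x = otail (last p)"
      using oriented_edgesD(2) e(2) p(3) by fastforce
    \<comment> \<open>A path whose last edge is incident to \<open>x\<close> either ends in
      \<open>x\<close> or visits \<open>x\<close> just before; in the second case its last edge is
      dropped.\<close>
    then obtain q where "bi_path B r q x"
    proof cases
      case 1
      then show thesis using that p(1) lp(3)[OF p(2)] by simp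
    next
      case 2
      obtain q a where q: "p = q @ [a]" using p(2) by (meson rev_exhaust)
      \<comment> \<open>A path consisting of \<open>a\<close> alone would have tail
        \<open>r\<close>, but its tail is \<open>x\<close> in \<open>C\<close>.\<close>
      have "q \<noteq> []" using 2 q lp(2)[OF p(2)] x r by auto
      then have "bi_trail B r q (ohead (last q))"
        using bi_trailI[OF root_in_verts, of q] lp(1,2) q by (auto simp: linked_trail_append)
      moreover have "ohead (last q) = x"
        using linked_trail_tail[of B q a "[]"] lp(1) q \<open>q \<noteq> []\<close> 2 by simp
      moreover have "distinct (trail_verts r q)"
        using p(1) q by (auto simp: bi_path_def trail_verts_def)
      ultimately show thesis using that by (simp add: bi_path_def)
    qed
    then show ?thesis unfolding lambda_path_def
      by (intro max_disjoint_eq_1[of q _ "oedge f"]) (use entry_in x in \<open>auto simp: bi_path_def\<close>)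
  qed
  ultimately show ?thesis by blast
qed

end
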